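(* Let $\alpha>0$ and let $K:[1,\infty)\to[0,\infty)$ be a non-negative function. Let $Z_n$, $n\in\mathbb N$, be a sequence of random variables on a probability space $(\Omega,\mathbf B,\mathbf P)$ such that $$\left(\mathbf E|Z_n|^p\right)^{1/p}\le K(p)\, n^{-\alpha}\qquad\text{for all } p\ge 1 \text{ and all } n\in\mathbb N .$$ Let $p$ and $\epsilon$ be such that $$\epsilon\in(0,\min\{1,\alpha\}),\qquad p>1/\epsilon .$$ Then the random variable $$\eta_{\alpha,\epsilon}:=\sup_{n\ge 2}\left\{ n^{\alpha-\epsilon}\,|Z_n|\right\}$$ satisfies $$\|\eta_{\alpha,\epsilon}\|_p\le K(p)\,(p\epsilon-1)^{-1/p}.$$
   Context: Random variables are numerical (real) valued. $\mathbf E$ denotes expectation with respect to $\mathbf P$, and $\|\xi\|_p=(\mathbf E|\xi|^p)^{1/p}$ for $1\le p<\infty$. $\mathbb N=\{1,2,3,\ldots\}$. *)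

theory Defs
  imports "HOL-Probability.Probability"
begin

text \<open>Real powers on \<open>[0, \<infinity>]\<close>, meant for exponents \<open>a > 0\<close>, so that \<open>\<infinity>\<close> to the power \<open>a\<close> is \<open>\<infinity>\<close>.\<close>

definition ennreal_powr :: "ennreal \<Rightarrow> real \<Rightarrow> ennreal" where
  "ennreal_powr x a = (if x = \<infinity> then \<infinity> else ennreal (enn2real x powr a))"

text \<open>
  The norm takes values in \<open>[0, \<infinity>]\<close> and the expectation is the nonnegative Lebesgue integral.
  Thus a finite upper bound on it entails integrability of the \<open>p\<close>-th absolute power, which a
  bound on a Bochner integral would not, since that is \<open>0\<close> for non-integrable functions.
  Arguments are extended real valued because a supremum of infinitely many random variables
  need not be finite at every point.
\<close>

definition Lp_norm :: "'a measure \<Rightarrow> real \<Rightarrow> ('a \<Rightarrow> ereal) \<Rightarrow> ennreal" where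
  "Lp_norm M p X =
     ennreal_powr (\<integral>\<^sup>+ \<omega>. ennreal_powr (e2ennreal \<bar>X \<omega>\<bar>) p \<partial>M) (1 / p)"

definition eta :: "(nat \<Rightarrow> 'a \<Rightarrow> real) \<Rightarrow> real \<Rightarrow> real \<Rightarrow> 'a \<Rightarrow> ereal" where
  "eta Z \<alpha> \<epsilon> \<omega> = (SUP n\<in>{2..}. ereal (real n powr (\<alpha> - \<epsilon>) * \<bar>Z n \<omega>\<bar>))"

end

theory Submission
  imports Defs
begin

text \<open>
  The \<open>p\<close>-th power of a supremum of non-negative functions is at most the sum of their \<open>p\<close>-th
  powers. Integrating termwise bounds the \<open>p\<close>-th moment of \<open>\<eta>\<close> by
  \<open>K(p)\<^sup>p \<Sum>\<^sub>n\<^sub>\<ge>\<^sub>2 n powr (- p \<epsilon>)\<close>, and since \<open>p \<epsilon> > 1\<close> this series is at most the integral of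
  \<open>x powr (- p \<epsilon>)\<close> over \<open>[1, \<infinity>)\<close>, which is \<open>1 / (p \<epsilon> - 1)\<close>.
\<close>

lemma ennreal_powr_ennreal [simp]:
  "0 \<le> x \<Longrightarrow> ennreal_powr (ennreal x) a = ennreal (x powr a)"
  by (simp add: ennreal_powr_def)

lemma ennreal_powr_mono:
  assumes "0 \<le> a" "x \<le> y"
  shows "ennreal_powr x a \<le> ennreal_powr y a"
proof (cases "y = \<infinity>")
  case False
  then have "x < \<infinity>" "y < \<infinity>" using assms(2) by (auto simp: less_top top_unique)
  then show ?thesis
    using assms by (auto simp: ennreal_powr_def intro!: ennreal_leI powr_mono2 enn2real_mono)
qed (simp add: ennreal_powr_def)

text \<open>Exponents multiply on finite arguments, and \<open>\<infinity>\<close> is fixed by every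
  power, so taking roots is reversible on all of \<open>[0, \<infinity>]\<close>.\<close>

lemma ennreal_powr_inverse:
  assumes "a \<noteq> 0"
  shows "ennreal_powr (ennreal_powr x (1 / a)) a = x"
    and "ennreal_powr (ennreal_powr x a) (1 / a) = x"
proof -
  have "ennreal_powr (ennreal_powr x (1 / a)) a = x \<and>
      ennreal_powr (ennreal_powr x a) (1 / a) = x"
  proof (cases x)
    case (real r)
    then show ?thesis using assms by (simp add: powr_powr)
  next
    case top
    then show ?thesis by (simp add: ennreal_powr_def)
  qed
  then show "ennreal_powr (ennreal_powr x (1 / a)) a = x"
    and "ennreal_powr (ennreal_powr x a) (1 / a) = x" by auto
qed

lemma borel_measurable_ennreal_powr [measurable]:
  "(\<lambda>x. ennreal_powr x a) \<in> borel_measurable borel"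
proof -
  have [measurable]: "Measurable.pred borel (\<lambda>x::ennreal. x = \<infinity>)"
    by (simp add: pred_def)
  show ?thesis unfolding ennreal_powr_def by measurable
qed

text \<open>Each \<open>f n\<close> is the \<open>1 / a\<close>-th power of one term of the series,
  hence at most the \<open>1 / a\<close>-th power of the whole sum. This bound passes to the
  supremum, and raising to the power \<open>a\<close> undoes the root, so no continuity of the power
  is involved.\<close>

lemma ennreal_powr_SUP_le_suminf:
  fixes f :: "nat \<Rightarrow> ennreal"
  assumes "0 < a"
  shows "ennreal_powr (SUP n. f n) a \<le> (\<Sum>n. ennreal_powr (f n) a)"
proof -
  let ?S = "\<Sum>n. ennreal_powr (f n) a"
  have "f n \<le> ennreal_powr ?S (1 / a)" for n
  proof -
    have "ennreal_powr (f n) a \<le> ?S"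
      using sum_le_suminf[of "\<lambda>n. ennreal_powr (f n) a" "{n}"] by simp
    then have "ennreal_powr (ennreal_powr (f n) a) (1 / a) \<le> ennreal_powr ?S (1 / a)"
      using assms by (intro ennreal_powr_mono) auto
    then show ?thesis using assms by (simp add: ennreal_powr_inverse)
  qed
  then have "ennreal_powr (SUP n. f n) a \<le> ennreal_powr (ennreal_powr ?S (1 / a)) a"
    using assms by (intro ennreal_powr_mono SUP_least) auto
  then show ?thesis using assms by (simp add: ennreal_powr_inverse)
qed

text \<open>Mean value theorem for \<open>x powr (1 - s)\<close> on \<open>[x, x + 1]\<close>: the
  intermediate point lies below \<open>x + 1\<close>, where the decreasing
  \<open>z powr (- s)\<close> is larger than at the right end. The right-hand side is built to
  telescope.\<close>

lemma powr_le_diff_powr: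
  fixes s x :: real
  assumes "1 < s" "0 < x"
  shows "(s - 1) * (x + 1) powr (- s) \<le> x powr (1 - s) - (x + 1) powr (1 - s)"
proof -
  have "\<exists>z. x < z \<and> z < x + 1 \<and> (x + 1) powr (1 - s) - x powr (1 - s)
          = (x + 1 - x) * ((1 - s) * z powr (- s))"
    using assms has_real_derivative_powr[of _ "1 - s"] by (intro MVT2) auto
  then obtain z where z: "x < z" "z < x + 1"
    "(x + 1) powr (1 - s) - x powr (1 - s) = (1 - s) * z powr (- s)" by auto
  have "(s - 1) * (x + 1) powr (- s) \<le> (s - 1) * z powr (- s)"
    using assms z by (intro mult_left_mono powr_mono2') auto
  then show ?thesis using z(3) by (simp add: algebra_simps)
qed

lemma suminf_powr_le:
  fixes s :: real
  assumes "1 < s"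
  shows "(\<Sum>n. ennreal (real (n + 2) powr (- s))) \<le> ennreal (1 / (s - 1))"
proof (rule suminf_le_const)
  fix N :: nat
  \<comment> \<open>The telescoped remainder is kept so that the induction closes. The leading 1 is
    \<open>1 powr (1 - s)\<close>, from the left end of the first interval
    \<open>[1, 2]\<close>.\<close>
  have "(s - 1) * (\<Sum>n<N. real (n + 2) powr (- s)) \<le> 1 - real (N + 1) powr (1 - s)"
  proof (induction N)
    case (Suc N)
    have "(s - 1) * real (N + 2) powr (- s)
        \<le> real (N + 1) powr (1 - s) - real (Suc N + 1) powr (1 - s)"
      using powr_le_diff_powr[OF assms, of "real (N + 1)"] by (simp add: add.commute)
    then show ?case using Suc.IH by (simp add: distrib_left)
  qed simp
  also have "\<dots> \<le> 1" by simp
  finally have "(\<Sum>n<N. real (n + 2) powr (- s)) \<le> 1 / (s - 1)"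
    using assms by (simp add: field_simps)
  then show "(\<Sum>n<N. ennreal (real (n + 2) powr (- s))) \<le> ennreal (1 / (s - 1))"
    by (subst sum_ennreal) (auto intro: ennreal_leI)
qed simp

lemma eta_nonneg: "0 \<le> eta Z \<alpha> \<epsilon> \<omega>"
  unfolding eta_def by (rule SUP_upper2[of 2]) auto

text \<open>Shifting the index by 2 turns the supremum over \<open>{2..}\<close> into one over all
  naturals, the form that the comparison with a series takes.\<close>

lemma e2ennreal_abs_eta_le:
  "e2ennreal \<bar>eta Z \<alpha> \<epsilon> \<omega>\<bar>
     \<le> (SUP n. ennreal (real (n + 2) powr (\<alpha> - \<epsilon>) * \<bar>Z (n + 2) \<omega>\<bar>))" (is "_ \<le> ?S")
proof -
  \<comment> \<open>The comparison is made termwise in \<open>ereal\<close>, where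
    \<open>eta\<close> takes its values; monotonicity of \<open>e2ennreal\<close> then carries it
    back.\<close>
  have "eta Z \<alpha> \<epsilon> \<omega> \<le> enn2ereal ?S"
    unfolding eta_def
  proof (rule SUP_least)
    fix n :: nat assume "n \<in> {2..}"
    then obtain m where n: "n = m + 2" by (metis atLeast_iff add.commute le_Suc_ex)
    have "ennreal (real n powr (\<alpha> - \<epsilon>) * \<bar>Z n \<omega>\<bar>) \<le> ?S"
      unfolding n by (rule SUP_upper) simp
    then have "enn2ereal (ennreal (real n powr (\<alpha> - \<epsilon>) * \<bar>Z n \<omega>\<bar>)) \<le> enn2ereal ?S"
      by (simp only: less_eq_ennreal.rep_eq)
    then show "ereal (real n powr (\<alpha> - \<epsilon>) * \<bar>Z n \<omega>\<bar>) \<le> enn2ereal ?S"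
      by (subst (asm) enn2ereal_ennreal) auto
  qed
  then have "e2ennreal (eta Z \<alpha> \<epsilon> \<omega>) \<le> e2ennreal (enn2ereal ?S)" by (rule e2ennreal_mono)
  then show ?thesis by (simp add: eta_nonneg)
qed

lemma borel_measurable_eta:
  assumes "\<And>n. 2 \<le> n \<Longrightarrow> Z n \<in> borel_measurable M"
  shows "eta Z \<alpha> \<epsilon> \<in> borel_measurable M"
proof -
  have "(\<lambda>\<omega>. SUP n\<in>{2..}. ereal (real n powr (\<alpha> - \<epsilon>) * \<bar>Z n \<omega>\<bar>)) \<in> borel_measurable M"
  proof (rule borel_measurable_SUP)
    fix n :: nat assume "n \<in> {2..}"
    then have [measurable]: "Z n \<in> borel_measurable M" using assms by simp
    show "(\<lambda>\<omega>. ereal (real n powr (\<alpha> - \<epsilon>) * \<bar>Z n \<omega>\<bar>)) \<in> borel_measurable M" by measurable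
  qed simp
  then show ?thesis unfolding eta_def[abs_def] .
qed

theorem theorem2p2:
  fixes M :: "'a measure" and Z :: "nat \<Rightarrow> 'a \<Rightarrow> real"
    and K :: "real \<Rightarrow> real" and \<alpha> \<epsilon> p :: real
  assumes "prob_space M"
    and "\<alpha> > 0"
    and "\<And>q. q \<ge> 1 \<Longrightarrow> K q \<ge> 0"
    and "\<And>n. n \<ge> 1 \<Longrightarrow> Z n \<in> borel_measurable M"
    and "\<And>q n. q \<ge> 1 \<Longrightarrow> n \<ge> 1 \<Longrightarrow>
           Lp_norm M q (\<lambda>\<omega>. ereal (Z n \<omega>)) \<le> ennreal (K q * real n powr (- \<alpha>))"
    and "0 < \<epsilon>" and "\<epsilon> < min 1 \<alpha>"
    and "p > 1 / \<epsilon>"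
  shows "eta Z \<alpha> \<epsilon> \<in> borel_measurable M
       \<and> (AE \<omega> in M. eta Z \<alpha> \<epsilon> \<omega> < \<infinity>)
       \<and> Lp_norm M p (eta Z \<alpha> \<epsilon>) \<le> ennreal (K p * (p * \<epsilon> - 1) powr (- 1 / p))"
proof -
  have p\<epsilon>: "1 < p * \<epsilon>" using assms(6,8) by (simp add: field_simps)
  \<comment> \<open>This makes the assumed norm bound applicable with \<open>q = p\<close>.\<close>
  have p: "1 < p"
  proof -
    have "1 < 1 / \<epsilon>" using assms(6,7) by simp
    then show ?thesis using assms(8) by linarith
  qed
  have Kp: "0 \<le> K p" using assms(3) p by simp
  have Z [measurable]: "Z (n + 2) \<in> borel_measurable M" for n using assms(4) by simp
  have eta [measurable]: "eta Z \<alpha> \<epsilon> \<in> borel_measurable M"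
    using assms(4) by (intro borel_measurable_eta) simp
  define c where "c n = real (n + 2) powr (\<alpha> - \<epsilon>)" for n
  have moment: "(\<integral>\<^sup>+ \<omega>. ennreal (\<bar>Z (n + 2) \<omega>\<bar> powr p) \<partial>M)
      \<le> ennreal ((K p * real (n + 2) powr (- \<alpha>)) powr p)" for n
  proof -
    \<comment> \<open>Raising the norm to the power \<open>p\<close> cancels its outer root and
      leaves the moment itself.\<close>
    have "ennreal_powr (Lp_norm M p (\<lambda>\<omega>. ereal (Z (n + 2) \<omega>))) p
        \<le> ennreal_powr (ennreal (K p * real (n + 2) powr (- \<alpha>))) p"
      using assms(5)[of p "n + 2"] p by (intro ennreal_powr_mono) auto
    then show ?thesis
      using p Kp by (simp add: Lp_norm_def ennreal_powr_inverse)
  qed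
  have term_le: "(\<integral>\<^sup>+ \<omega>. ennreal ((c n * \<bar>Z (n + 2) \<omega>\<bar>) powr p) \<partial>M)
      \<le> ennreal (K p powr p) * ennreal (real (n + 2) powr (- (p * \<epsilon>)))" for n
  proof -
    have "(\<integral>\<^sup>+ \<omega>. ennreal ((c n * \<bar>Z (n + 2) \<omega>\<bar>) powr p) \<partial>M)
        = ennreal (c n powr p) * (\<integral>\<^sup>+ \<omega>. ennreal (\<bar>Z (n + 2) \<omega>\<bar> powr p) \<partial>M)"
      by (simp only: powr_mult ennreal_mult powr_ge_zero) (intro nn_integral_cmult, measurable)
    also have "\<dots> \<le> ennreal (c n powr p) * ennreal ((K p * real (n + 2) powr (- \<alpha>)) powr p)"
      by (intro mult_left_mono moment) simp
    also have "\<dots> = ennreal (K p powr p * (c n powr p * (real (n + 2) powr (- \<alpha>)) powr p))"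
      using Kp by (simp add: powr_mult ennreal_mult mult_ac)
    \<comment> \<open>The exponents add up to
      \<open>p * (\<alpha> - \<epsilon>) - p * \<alpha>\<close>, so \<alpha> cancels.\<close>
    also have "c n powr p * (real (n + 2) powr (- \<alpha>)) powr p = real (n + 2) powr (- (p * \<epsilon>))"
      by (simp add: c_def powr_powr powr_add[symmetric] algebra_simps)
    finally show ?thesis by (simp add: ennreal_mult)
  qed
  have bound: "(\<integral>\<^sup>+ \<omega>. ennreal_powr (e2ennreal \<bar>eta Z \<alpha> \<epsilon> \<omega>\<bar>) p \<partial>M)
      \<le> ennreal (K p powr p / (p * \<epsilon> - 1))"
  proof -
    have "ennreal_powr (e2ennreal \<bar>eta Z \<alpha> \<epsilon> \<omega>\<bar>) p
        \<le> (\<Sum>n. ennreal ((c n * \<bar>Z (n + 2) \<omega>\<bar>) powr p))" for \<omega>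
    proof -
      have "ennreal_powr (e2ennreal \<bar>eta Z \<alpha> \<epsilon> \<omega>\<bar>) p
          \<le> ennreal_powr (SUP n. ennreal (c n * \<bar>Z (n + 2) \<omega>\<bar>)) p"
        using p unfolding c_def by (intro ennreal_powr_mono e2ennreal_abs_eta_le) simp
      also have "\<dots> \<le> (\<Sum>n. ennreal_powr (ennreal (c n * \<bar>Z (n + 2) \<omega>\<bar>)) p)"
        using p by (intro ennreal_powr_SUP_le_suminf) simp
      finally show ?thesis by (simp add: c_def)
    qed
    then have "(\<integral>\<^sup>+ \<omega>. ennreal_powr (e2ennreal \<bar>eta Z \<alpha> \<epsilon> \<omega>\<bar>) p \<partial>M)
        \<le> (\<integral>\<^sup>+ \<omega>. (\<Sum>n. ennreal ((c n * \<bar>Z (n + 2) \<omega>\<bar>) powr p)) \<partial>M)"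
      by (intro nn_integral_mono)
    also have "\<dots> = (\<Sum>n. \<integral>\<^sup>+ \<omega>. ennreal ((c n * \<bar>Z (n + 2) \<omega>\<bar>) powr p) \<partial>M)"
      by (intro nn_integral_suminf) measurable
    also have "\<dots> \<le> (\<Sum>n. ennreal (K p powr p) * ennreal (real (n + 2) powr (- (p * \<epsilon>))))"
      by (intro suminf_le term_le) auto
    also have "\<dots> = ennreal (K p powr p) * (\<Sum>n. ennreal (real (n + 2) powr (- (p * \<epsilon>))))"
      by (rule ennreal_suminf_cmult)
    also have "\<dots> \<le> ennreal (K p powr p) * ennreal (1 / (p * \<epsilon> - 1))"
      by (intro mult_left_mono suminf_powr_le p\<epsilon>) simp
    finally show ?thesis using p\<epsilon> by (simp add: ennreal_mult[symmetric])
  qed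
  \<comment> \<open>A finite integral forces an almost everywhere finite integrand. As
    \<open>ennreal_powr\<close> sends \<open>\<infinity>\<close> to \<open>\<infinity>\<close>,
    \<open>eta\<close> itself is then finite there.\<close>
  have "AE \<omega> in M. ennreal_powr (e2ennreal \<bar>eta Z \<alpha> \<epsilon> \<omega>\<bar>) p \<noteq> \<infinity>"
    using bound by (intro nn_integral_PInf_AE) (auto simp: top_unique)
  then have finite: "AE \<omega> in M. eta Z \<alpha> \<epsilon> \<omega> < \<infinity>"
    by eventually_elim (auto simp: ennreal_powr_def less_top[symmetric])
  have "Lp_norm M p (eta Z \<alpha> \<epsilon>) \<le> ennreal_powr (ennreal (K p powr p / (p * \<epsilon> - 1))) (1 / p)"
    unfolding Lp_norm_def using bound p by (intro ennreal_powr_mono) auto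
  \<comment> \<open>Since \<open>K p\<close> is non-negative, the root of \<open>K p powr p\<close>
    is \<open>K p\<close> itself.\<close>
  also have "\<dots> = ennreal (K p * (p * \<epsilon> - 1) powr (- 1 / p))"
    using p p\<epsilon> Kp by (simp add: powr_divide powr_powr powr_minus_divide)
  finally show ?thesis using eta finite by blast
qed

end
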